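(* Let $n\ge2$ and let $X\in M(n,\mathbb{C})$ with $\|X\|=1$. Write $X=A+B$ for the canonical decomposition with $A$ Hermitian and $B$ skew-Hermitian. Let $\sigma_1(X)\ge\cdots\ge\sigma_n(X)$ be the singular values of $X$, let $a_1,\dots,a_n$ be the (real) eigenvalues of $A$ and $b_1\mathbf{i},\dots,b_n\mathbf{i}$ ($b_j\in\mathbb{R}$) the eigenvalues of $B$, counted with multiplicity. Then $$\lambda_1(T_X)\le 2\Big(\max_{i,j}\{-a_ia_j\}+\max_{i,j}\{-b_ib_j\}\Big)+\Big(\sigma_1^2(X)+\sigma_2^2(X)\Big)\le2,$$ where the maxima are over all $1\le i,j\le n$.
   Context: $M(n,\mathbb{C})$ is the space of complex $n\times n$ matrices, $X^*$ is the conjugate transpose, $\|X\|=\sqrt{\operatorname{Tr}XX^*}$ is the Frobenius norm, $[X,Y]=XY-YX$, $\mathbf{i}=\sqrt{-1}$. $T_X$ is the linear map on $M(n,\mathbb{C})$ given by $T_X(Y)=[X^*,[X,Y]]$; it is self-adjoint and positive semi-definite for $\langle Y,Z\rangle=\operatorname{Tr}(YZ^* )$, and $\lambda_1(T_X)$ is its largest eigenvalue. *)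

theory Defs
  imports "Jordan_Normal_Form.Schur_Decomposition"
begin

definition mat_trace :: "'a :: comm_monoid_add mat \<Rightarrow> 'a" where
  "mat_trace X = (\<Sum>i<dim_row X. X $$ (i, i))"

(* The trace of X times its adjoint is a nonnegative real, so Re loses nothing. *)
definition frobenius_norm :: "complex mat \<Rightarrow> real" where
  "frobenius_norm X = sqrt (Re (mat_trace (X * mat_adjoint X)))"

definition hermitian_mat :: "complex mat \<Rightarrow> bool" where
  "hermitian_mat X \<longleftrightarrow> mat_adjoint X = X"

definition skew_hermitian_mat :: "complex mat \<Rightarrow> bool" where
  "skew_hermitian_mat X \<longleftrightarrow> mat_adjoint X = - X"

definition commutator :: "complex mat \<Rightarrow> complex mat \<Rightarrow> complex mat" where
  "commutator X Y = X * Y - Y * X"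

definition T_map :: "complex mat \<Rightarrow> complex mat \<Rightarrow> complex mat" where
  "T_map X Y = commutator (mat_adjoint X) (commutator X Y)"

definition mat_map_eigenvalue :: "nat \<Rightarrow> (complex mat \<Rightarrow> complex mat) \<Rightarrow> complex \<Rightarrow> bool" where
  "mat_map_eigenvalue n T k \<longleftrightarrow>
     (\<exists>Y \<in> carrier_mat n n. Y \<noteq> 0\<^sub>m n n \<and> T Y = k \<cdot>\<^sub>m Y)"

(* For square X of positive dimension, T_map X is self-adjoint on a nonzero finite-dimensional
   space: all of its eigenvalues are real, and the set below is finite and nonempty. *)
definition lambda1_T :: "complex mat \<Rightarrow> real" where
  "lambda1_T X = Max {t. mat_map_eigenvalue (dim_row X) (T_map X) (complex_of_real t)}"

(* e 1, ..., e n are the eigenvalues of A with algebraic multiplicity, in some order. *)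
definition enumerates_eigenvalues :: "complex mat \<Rightarrow> nat \<Rightarrow> (nat \<Rightarrow> complex) \<Rightarrow> bool" where
  "enumerates_eigenvalues A n e \<longleftrightarrow> char_poly A = (\<Prod>i = 1..n. [:- e i, 1:])"

(* The singular values are the nonnegative square roots of the eigenvalues of X^* X. *)
definition ordered_singular_values :: "complex mat \<Rightarrow> nat \<Rightarrow> (nat \<Rightarrow> real) \<Rightarrow> bool" where
  "ordered_singular_values X n s \<longleftrightarrow>
     (\<forall>i \<in> {1..n}. 0 \<le> s i) \<and>
     (\<forall>i \<in> {1..n}. \<forall>j \<in> {1..n}. i \<le> j \<longrightarrow> s j \<le> s i) \<and>
     enumerates_eigenvalues (mat_adjoint X * X) n (\<lambda>i. complex_of_real ((s i)\<^sup>2))"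

end

theory Submission
  imports Defs
begin

text \<open>
  If \<open>Y\<close> is an eigenvector of \<open>T_map X\<close> for \<open>t\<close>, then pairing \<open>T_map X Y = t Y\<close> with \<open>Y\<close>
  gives \<open>\<parallel>[X, Y]\<parallel>\<^sup>2 = t \<parallel>Y\<parallel>\<^sup>2\<close>, so eigenvalues are bounded by bounding the squared norm of a
  commutator (\<open>frobenius_sq_commutator\<close>):
  \<open>\<parallel>[X, Y]\<parallel>\<^sup>2 = (tr (X\<^sup>* X Y Y\<^sup>*) + tr (Y X X\<^sup>* Y\<^sup>*)) - 2 Re (tr (X Y X\<^sup>* Y\<^sup>*))\<close>.

  In the last term, substituting \<open>X = A + B\<close> makes the mixed terms purely imaginary, which leaves
  \<open>- 2 tr (A Y A Y\<^sup>*) + 2 tr (B Y B Y\<^sup>*)\<close>. In an orthonormal eigenbasis of \<open>A\<close> the first trace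
  is a sum of \<open>a\<^sub>i a\<^sub>j\<close> with weights that add up to \<open>\<parallel>Y\<parallel>\<^sup>2\<close>, and similarly for \<open>B\<close>; this
  accounts for the two maxima. In the same way, if the unitary matrices \<open>V\<close> and \<open>U\<close> diagonalize
  \<open>X\<^sup>* X\<close> and \<open>X X\<^sup>*\<close>, then the bracket is the sum of \<open>(\<sigma>\<^sub>i\<^sup>2 + \<sigma>\<^sub>j\<^sup>2) |Z\<^sub>i\<^sub>j|\<^sup>2\<close> with
  \<open>Z = V\<^sup>* Y U\<close>. The only coefficient that can exceed \<open>\<sigma>\<^sub>1\<^sup>2 + \<sigma>\<^sub>2\<^sup>2\<close> is the first one,
  \<open>2 \<sigma>\<^sub>1\<^sup>2\<close>, so the bound holds for every \<open>Y\<close> whose \<open>Z\<close> has vanishing first entry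
  (\<open>commutator_bound\<close>).

  Such an eigenvector exists because every eigenspace for \<open>t \<noteq> 0\<close> has dimension at least two:
  with \<open>Y\<close> it contains \<open>[X, Y]\<^sup>*\<close>, which is nonzero and orthogonal to \<open>Y\<close>
  (\<open>T_map_adjoint_commutator_eigenvector\<close>), and the vanishing of one entry of \<open>Z\<close> is a single
  linear condition (\<open>T_map_eigenvector_in_hyperplane\<close>). For \<open>t \<le> 0\<close> it suffices that the bound
  is nonnegative, which follows from \<open>commutator_bound\<close> for any nonzero \<open>Y\<close> of this kind.

  The second inequality follows from \<open>- 2 a\<^sub>i a\<^sub>j \<le> \<parallel>A\<parallel>\<^sup>2\<close>, \<open>- 2 b\<^sub>i b\<^sub>j \<le> \<parallel>B\<parallel>\<^sup>2\<close>,
  \<open>\<parallel>A\<parallel>\<^sup>2 + \<parallel>B\<parallel>\<^sup>2 = \<parallel>X\<parallel>\<^sup>2 = 1\<close> and \<open>\<sigma>\<^sub>1\<^sup>2 + \<sigma>\<^sub>2\<^sup>2 \<le> \<parallel>X\<parallel>\<^sup>2 = 1\<close>.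
\<close>

section \<open>Adjoint, trace and Frobenius norm\<close>

lemma mat_adjoint_carrier [simp]:
  "X \<in> carrier_mat n m \<Longrightarrow> mat_adjoint X \<in> carrier_mat m n"
  unfolding mat_adjoint_def by auto

lemma mat_adjoint_dim [simp]:
  "dim_row (mat_adjoint X) = dim_col X" "dim_col (mat_adjoint X) = dim_row X"
  unfolding mat_adjoint_def by auto

lemma mat_adjoint_index [simp]:
  fixes X :: "complex mat"
  assumes "i < dim_col X" "j < dim_row X"
  shows "mat_adjoint X $$ (i, j) = cnj (X $$ (j, i))"
  using assms unfolding mat_adjoint_def by (simp add: mat_of_rows_index)

lemma mat_adjoint_adjoint [simp]: "mat_adjoint (mat_adjoint X) = (X :: complex mat)"
  by (rule eq_matI) auto

lemma mat_adjoint_one [simp]: "mat_adjoint (1\<^sub>m n) = (1\<^sub>m n :: complex mat)"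
  by (rule eq_matI) auto

lemma mat_adjoint_mult:
  fixes X Y :: "complex mat"
  assumes "X \<in> carrier_mat n m" "Y \<in> carrier_mat m k"
  shows "mat_adjoint (X * Y) = mat_adjoint Y * mat_adjoint X"
  using assms by (intro eq_matI) (auto simp: scalar_prod_def mult.commute)

lemma mat_adjoint_add:
  fixes X Y :: "complex mat"
  assumes "X \<in> carrier_mat n m" "Y \<in> carrier_mat n m"
  shows "mat_adjoint (X + Y) = mat_adjoint X + mat_adjoint Y"
  using assms by (intro eq_matI) auto

lemma mat_adjoint_minus:
  fixes X Y :: "complex mat"
  assumes "X \<in> carrier_mat n m" "Y \<in> carrier_mat n m"
  shows "mat_adjoint (X - Y) = mat_adjoint X - mat_adjoint Y"
  using assms by (intro eq_matI) auto

lemma mat_adjoint_smult: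
  "mat_adjoint (c \<cdot>\<^sub>m X) = cnj c \<cdot>\<^sub>m mat_adjoint (X :: complex mat)"
  by (rule eq_matI) auto

lemma mat_adjoint_four_block:
  fixes A B C D :: "complex mat"
  assumes "A \<in> carrier_mat n1 m1" "B \<in> carrier_mat n1 m2"
    and "C \<in> carrier_mat n2 m1" "D \<in> carrier_mat n2 m2"
  shows "mat_adjoint (four_block_mat A B C D) =
    four_block_mat (mat_adjoint A) (mat_adjoint C) (mat_adjoint B) (mat_adjoint D)"
  using assms by (intro eq_matI) auto

lemma mat_trace_mult:
  fixes P Q :: "'a :: comm_semiring_0 mat"
  assumes "P \<in> carrier_mat n m" "Q \<in> carrier_mat m n"
  shows "mat_trace (P * Q) = (\<Sum>i<n. \<Sum>j<m. P $$ (i, j) * Q $$ (j, i))"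
  using assms by (auto simp: mat_trace_def scalar_prod_def atLeast0LessThan intro!: sum.cong)

lemma mat_trace_comm:
  fixes P Q :: "'a :: comm_semiring_0 mat"
  assumes "P \<in> carrier_mat n m" "Q \<in> carrier_mat m n"
  shows "mat_trace (P * Q) = mat_trace (Q * P)"
  unfolding mat_trace_mult[OF assms] mat_trace_mult[OF assms(2,1)]
  by (subst sum.swap) (simp add: mult.commute)

lemma mat_trace_add:
  assumes "P \<in> carrier_mat n n" "Q \<in> carrier_mat n n"
  shows "mat_trace (P + Q) = mat_trace P + mat_trace Q"
  using assms by (auto simp: mat_trace_def sum.distrib)

lemma mat_trace_minus:
  fixes P Q :: "'a :: ab_group_add mat"
  assumes "P \<in> carrier_mat n n" "Q \<in> carrier_mat n n"
  shows "mat_trace (P - Q) = mat_trace P - mat_trace Q"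
  using assms by (auto simp: mat_trace_def sum_subtractf)

lemma mat_trace_smult:
  fixes P :: "'a :: semiring_0 mat"
  assumes "P \<in> carrier_mat n n"
  shows "mat_trace (c \<cdot>\<^sub>m P) = c * mat_trace P"
  using assms by (auto simp: mat_trace_def sum_distrib_left)

lemma mat_trace_adjoint:
  fixes P :: "complex mat"
  assumes "P \<in> carrier_mat n n"
  shows "mat_trace (mat_adjoint P) = cnj (mat_trace P)"
  using assms by (auto simp: mat_trace_def)

definition frobenius_sq :: "complex mat \<Rightarrow> real" where
  "frobenius_sq Y = (\<Sum>i<dim_row Y. \<Sum>j<dim_col Y. (cmod (Y $$ (i, j)))\<^sup>2)"

lemma frobenius_sq_trace:
  assumes "Y \<in> carrier_mat n m"
  shows "mat_trace (Y * mat_adjoint Y) = of_real (frobenius_sq Y)"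
  unfolding mat_trace_mult[OF assms mat_adjoint_carrier[OF assms]]
  using assms by (auto simp: frobenius_sq_def complex_norm_square simp del: of_real_power intro!: sum.cong)

lemma frobenius_sq_pos:
  assumes "Y \<in> carrier_mat n m" "Y \<noteq> 0\<^sub>m n m"
  shows "0 < frobenius_sq Y"
proof -
  obtain i j where ij: "i < n" "j < m" "Y $$ (i, j) \<noteq> 0"
    using assms by (metis carrier_matD eq_matI index_zero_mat)
  have "0 < (cmod (Y $$ (i, j)))\<^sup>2" using ij by simp
  also have "\<dots> \<le> (\<Sum>j<m. (cmod (Y $$ (i, j)))\<^sup>2)"
    using ij by (intro member_le_sum) auto
  also have "\<dots> \<le> frobenius_sq Y"
    using ij assms unfolding frobenius_sq_def
    by (auto intro!: member_le_sum[where f = "\<lambda>i. \<Sum>j<m. (cmod (Y $$ (i, j)))\<^sup>2"] sum_nonneg)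
  finally show ?thesis .
qed

section \<open>Unitary diagonalization\<close>

text \<open>Gram-Schmidt applied to a basis that starts with \<open>v\<close> leaves \<open>v\<close> in front; scaling the
  resulting orthogonal vectors to length one gives the columns of \<open>U\<close>.\<close>

lemma exists_orthonormal_columns:
  fixes v :: "complex vec"
  assumes v: "v \<in> carrier_vec n" "v \<noteq> 0\<^sub>v n"
  shows "\<exists>U c. U \<in> carrier_mat n n \<and> mat_adjoint U * U = 1\<^sub>m n \<and> col U 0 = c \<cdot>\<^sub>v v"
proof -
  interpret cof_vec_space n "TYPE(complex)" .
  define ws where "ws = gram_schmidt n (basis_completion v)"
  note b = basis_completion[OF v]
  have n: "n \<noteq> 0" using v by (metis eq_vecI carrier_vecD index_zero_vec(2) not_less_zero)
  obtain vs where bv: "basis_completion v = v # vs"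
    using b(6,7) n by (cases "basis_completion v") auto
  from gram_schmidt_result[OF b(2,4,5) refl, folded ws_def]
  have ws: "set ws \<subseteq> carrier_vec n" "corthogonal ws" "length ws = n" by (auto simp: b(6))
  have hd: "ws ! 0 = v"
    using gram_schmidt_hd[OF v(1), of vs, folded bv ws_def] ws(3) n by (cases ws) auto
  define r where "r j = sqrt (\<Sum>k<n. (cmod (ws ! j $ k))\<^sup>2)" for j
  define U where "U = mat n n (\<lambda>(i, j). ws ! j $ i / of_real (r j))"
  have wc: "dim_vec (ws ! j) = n" if "j < n" for j using ws that by (metis carrier_vecD nth_mem subsetD)
  have ip: "ws ! j \<bullet>c ws ! i = (\<Sum>k<n. cnj (ws ! i $ k) * ws ! j $ k)" if "i < n" "j < n" for i j
    using that wc by (auto simp: scalar_prod_def atLeast0LessThan mult.commute intro!: sum.cong)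
  have rr: "ws ! j \<bullet>c ws ! j = of_real ((r j)\<^sup>2)" if "j < n" for j
    unfolding ip[OF that that] r_def
    by (simp add: sum_nonneg complex_norm_square mult.commute del: of_real_power)
  have r0: "r j \<noteq> 0" if "j < n" for j
    using corthogonalD[OF ws(2), of j j] that ws(3) rr[OF that] by auto
  have "mat_adjoint U * U = 1\<^sub>m n"
  proof (rule eq_matI)
    fix i j assume ij: "i < dim_row (1\<^sub>m n :: complex mat)" "j < dim_col (1\<^sub>m n :: complex mat)"
    have "(mat_adjoint U * U) $$ (i, j) =
        (\<Sum>k<n. cnj (ws ! i $ k) * ws ! j $ k) / of_real (r i * r j)"
      using ij by (auto simp: U_def scalar_prod_def atLeast0LessThan sum_divide_distrib intro!: sum.cong)
    also have "\<dots> = (if i = j then 1 else 0)"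
      using ij corthogonalD[OF ws(2), of j i] ws(3) ip[of i j, symmetric] rr[of i] r0[of i]
      by (auto simp: power2_eq_square)
    finally show "(mat_adjoint U * U) $$ (i, j) = 1\<^sub>m n $$ (i, j)" using ij by simp
  qed (auto simp: U_def)
  moreover have "col U 0 = (1 / of_real (r 0)) \<cdot>\<^sub>v v"
    using n v hd by (intro eq_vecI) (auto simp: U_def)
  ultimately show ?thesis unfolding U_def by (meson mat_carrier)
qed

text \<open>Unitary similarity is expressed as \<open>similar_mat_wit A T U (mat_adjoint U)\<close>: this contains
  both that \<open>U\<close> is unitary and that \<open>A = U T U\<^sup>*\<close>. The induction splits off a unit eigenvector
  for the first listed eigenvalue: in an orthonormal basis that starts with it, the first column of
  \<open>A\<close> is zero below the diagonal, and the remaining block has the remaining eigenvalues.\<close>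

lemma unitary_schur:
  fixes A :: "complex mat"
  assumes "A \<in> carrier_mat n n" "char_poly A = (\<Prod>e\<leftarrow>es. [:- e, 1:])"
  shows "\<exists>T U. similar_mat_wit A T U (mat_adjoint U) \<and> upper_triangular T \<and> diag_mat T = es"
  using assms
proof (induction es arbitrary: n A)
  case Nil
  with degree_monic_char_poly[of A n] show ?case
    by (intro exI[of _ A] exI[of _ "1\<^sub>m n"]) (auto simp: diag_mat_def intro: similar_mat_wit_refl)
next
  case (Cons e es n A)
  note A = Cons.prems(1)
  have cp: "char_poly A = [:- e, 1:] * (\<Prod>e\<leftarrow>es. [:- e, 1:])" using Cons.prems by simp
  have "eigenvalue A e" unfolding eigenvalue_root_char_poly[OF A] cp by simp
  then obtain v where v: "v \<in> carrier_vec n" "v \<noteq> 0\<^sub>v n" "A *\<^sub>v v = e \<cdot>\<^sub>v v"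
    using A unfolding eigenvalue_def eigenvector_def by auto
  have "n \<noteq> 0" using v by (metis eq_vecI carrier_vecD index_zero_vec(2) not_less_zero)
  then obtain m where n: "n = Suc m" by (cases n) auto
  obtain W c where W: "W \<in> carrier_mat n n" "mat_adjoint W * W = 1\<^sub>m n" "col W 0 = c \<cdot>\<^sub>v v"
    using exists_orthonormal_columns[OF v(1,2)] by blast
  have W': "W * mat_adjoint W = 1\<^sub>m n"
    using mat_mult_left_right_inverse[OF _ W(1) W(2)] W(1) by simp
  define A' where "A' = mat_adjoint W * A * W"
  have A': "A' \<in> carrier_mat n n" using A W unfolding A'_def by auto
  have "similar_mat_wit A' A (mat_adjoint W) W"
    by (rule similar_mat_witI[of _ _ n]) (insert A A' W W', auto simp: A'_def)
  then have sim: "similar_mat_wit A A' W (mat_adjoint W)" by (rule similar_mat_wit_sym)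
  have "A' = mat_adjoint W * (A * W)"
    unfolding A'_def using A W by (auto intro: assoc_mult_mat)
  then have "col A' 0 = mat_adjoint W *\<^sub>v col (A * W) 0"
    by (simp only:) (rule col_mult2[of _ n n _ n], use A W(1) n in auto)
  also have "col (A * W) 0 = A *\<^sub>v col W 0"
    using n by (intro col_mult2[OF A W(1)]) simp
  also have "A *\<^sub>v col W 0 = e \<cdot>\<^sub>v col W 0"
    unfolding W(3) using A v by (simp add: mult_mat_vec smult_smult_assoc mult.commute)
  also have "mat_adjoint W *\<^sub>v (e \<cdot>\<^sub>v col W 0) = e \<cdot>\<^sub>v col (mat_adjoint W * W) 0"
    using W(1) n mult_mat_vec[of "mat_adjoint W" n n "col W 0" e]
    by (auto simp: col_mult2[of _ n n _ n])
  finally have col0: "col A' 0 = e \<cdot>\<^sub>v unit_vec n 0" unfolding W(2) using n by simp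
  have A'0: "A' $$ (i, 0) = (if i = 0 then e else 0)" if "i < n" for i
    using arg_cong[OF col0, of "\<lambda>u. u $ i"] that A' n by auto
  define A1 A2 A3 where "A1 = mat 1 1 (\<lambda>_. e)" and "A2 = mat 1 m (\<lambda>(i, j). A' $$ (0, Suc j))"
    and "A3 = mat m m (\<lambda>(i, j). A' $$ (Suc i, Suc j))"
  have carr: "A1 \<in> carrier_mat 1 1" "A2 \<in> carrier_mat 1 m" "A3 \<in> carrier_mat m m"
    unfolding A1_def A2_def A3_def by auto
  have block: "A' = four_block_mat A1 A2 (0\<^sub>m m 1) A3"
    using A' n A'0 by (intro eq_matI) (auto simp: A1_def A2_def A3_def)
  have "char_poly A1 * char_poly A3 = char_poly A"
    unfolding char_poly_four_block_zeros_col[OF carr, symmetric] block[symmetric]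
    using sim by (intro char_poly_similar[symmetric]) (auto simp: similar_mat_def)
  moreover have "char_poly A1 = [:- e, 1:]"
    by (simp add: A1_def char_poly_defs det_def sign_def)
  ultimately have "char_poly A3 = (\<Prod>e\<leftarrow>es. [:- e, 1:])"
    unfolding cp by (metis mult_cancel_left pCons_eq_0_iff zero_neq_one)
  from Cons.IH[OF carr(3) this] obtain T U where
    TU: "similar_mat_wit A3 T U (mat_adjoint U)" "upper_triangular T" "diag_mat T = es" by blast
  note TUc = similar_mat_witD2[OF carr(3) TU(1)]
  define P where "P = four_block_mat (1\<^sub>m 1) (0\<^sub>m 1 m) (0\<^sub>m m 1) U"
  define S where "S = four_block_mat A1 (A2 * U) (0\<^sub>m m 1) T"
  have zero_adj: "mat_adjoint (0\<^sub>m k l) = (0\<^sub>m l k :: complex mat)" for k l by (rule eq_matI) auto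
  have adjP: "mat_adjoint P = four_block_mat (1\<^sub>m 1) (0\<^sub>m 1 m) (0\<^sub>m m 1) (mat_adjoint U)"
    unfolding P_def using TUc
    by (subst mat_adjoint_four_block[of _ 1 1 _ m _ m]) (auto simp: zero_adj)
  have P: "P \<in> carrier_mat n n" unfolding P_def n using TUc by auto
  have "similar_mat_wit A' S P (mat_adjoint P)"
    unfolding adjP unfolding block S_def P_def
    by (rule similar_mat_wit_four_block[OF similar_mat_wit_refl[OF carr(1)] TU(1) _ _ carr(1,3)])
      (insert carr TUc assoc_mult_mat[of A2 1 m U m "mat_adjoint U" m], auto)
  from similar_mat_wit_trans[OF sim this]
  have "similar_mat_wit A S (W * P) (mat_adjoint (W * P))"
    unfolding mat_adjoint_mult[OF W(1) P] .
  moreover have "upper_triangular S"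
    unfolding S_def using TUc carr TU
    by (intro upper_triangular_four_block[OF carr(1)]) (auto simp: A1_def)
  moreover have "diag_mat S = e # es"
    unfolding S_def diag_four_block_mat[OF carr(1) TUc(5)] TU(3) by (simp add: A1_def diag_mat_def)
  ultimately show ?case by blast
qed

text \<open>When all factors are square of the same size \<open>n\<close>, fixing \<open>n\<close> lets the simplifier discharge
  the side conditions of associativity and distributivity, which otherwise contain undetermined
  inner dimensions.\<close>

lemmas square_mat_simps =
  assoc_mult_mat[of A n n B n C n] minus_mult_distrib_mat[of A n n B C n]
  mult_minus_distrib_mat[of A n n B n C] add_mult_distrib_mat[of A n n B C n]
  mult_add_distrib_mat[of A n n B n C] mult_smult_distrib[of A n n B n k]
  mult_smult_assoc_mat[of A n n B n k] mult_carrier_mat[of A n n B n]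
  minus_carrier_mat[of B n n A]
  mat_adjoint_mult[of A n n B n] mat_adjoint_minus[of A n n B] mat_adjoint_add[of A n n B]
  mat_trace_add[of A n B] mat_trace_minus[of A n B] mat_trace_smult[of A n k]
  for n A B C k

text \<open>The hypothesis \<open>A\<^sup>* = c A\<close> covers Hermitian and skew-Hermitian matrices at once. It passes to the
  Schur form \<open>T\<close>; an entry of \<open>T\<close> above the diagonal is the conjugate of an entry of
  \<open>T\<^sup>* = c T\<close> below the diagonal, hence zero.\<close>

lemma unitary_diagonalization:
  fixes A :: "complex mat"
  assumes A: "A \<in> carrier_mat n n" and adj: "mat_adjoint A = c \<cdot>\<^sub>m A"
    and cp: "char_poly A = (\<Prod>i = 1..n. [:- e i, 1:])"
  shows "\<exists>U. similar_mat_wit A (mat_diag n (\<lambda>i. e (Suc i))) U (mat_adjoint U)"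
proof -
  let ?es = "map e [1..<Suc n]"
  have "char_poly A = (\<Prod>e\<leftarrow>?es. [:- e, 1:])"
    unfolding cp by (simp add: o_def interv_sum_list_conv_sum_set_nat prod.distinct_set_conv_list[symmetric] atLeastLessThanSuc_atLeastAtMost del: upt_Suc)
  from unitary_schur[OF A this] obtain T U where
    sim: "similar_mat_wit A T U (mat_adjoint U)" and ut: "upper_triangular T"
    and diag: "diag_mat T = ?es" by blast
  note c = similar_mat_witD2[OF A sim]
  have T: "T = mat_adjoint U * A * U"
    using similar_mat_witD2[OF c(5) similar_mat_wit_sym[OF sim]] by blast
  have "mat_adjoint T = mat_adjoint U * mat_adjoint A * U"
    unfolding T using A c(6)
    by (simp add: square_mat_simps[where n = n])
  also have "\<dots> = c \<cdot>\<^sub>m T"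
    unfolding adj T using A c(6) by (simp add: square_mat_simps[where n = n])
  finally have Tadj: "mat_adjoint T = c \<cdot>\<^sub>m T" .
  have "T = mat_diag n (\<lambda>i. e (Suc i))"
  proof (rule eq_matI)
    fix i j assume "i < dim_row (mat_diag n (\<lambda>i. e (Suc i)))" "j < dim_col (mat_diag n (\<lambda>i. e (Suc i)))"
    then have ij: "i < n" "j < n" by (auto simp: mat_diag_def)
    consider "i = j" | "j < i" | "i < j" by linarith
    then have "T $$ (i, j) = (if i = j then e (Suc j) else 0)"
    proof cases
      case 1
      have "diag_mat T ! i = T $$ (i, i)" using ij c by (simp add: diag_mat_def)
      moreover have "?es ! i = e (Suc i)" using ij by (simp del: upt_Suc)
      ultimately show ?thesis using 1 diag by simp
    next
      case 2
      then show ?thesis using ut ij c by auto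
    next
      case 3
      then have "T $$ (j, i) = 0" using ut ij c by auto
      then have "mat_adjoint T $$ (j, i) = 0" unfolding Tadj using ij c by simp
      then show ?thesis using 3 ij c by simp
    qed
    then show "T $$ (i, j) = mat_diag n (\<lambda>i. e (Suc i)) $$ (i, j)" using ij by (simp add: mat_diag_def)
  qed (use c in \<open>auto simp: mat_diag_def\<close>)
  with sim show ?thesis by auto
qed

text \<open>For singular \<open>A\<close> the matrices \<open>A B\<close> and \<open>B A\<close> need not be similar, but the block matrices
  \<open>(A B, 0; B, 0)\<close> and \<open>(0, 0; B, B A)\<close> always are, by a unipotent block matrix. This yields that
  \<open>X\<^sup>* X\<close> and \<open>X X\<^sup>*\<close> have the same eigenvalues without a singular value decomposition.\<close>

lemma char_poly_mult_comm:
  fixes A B :: "complex mat"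
  assumes A: "A \<in> carrier_mat n n" and B: "B \<in> carrier_mat n n"
  shows "char_poly (A * B) = char_poly (B * A)"
proof -
  let ?Z = "0\<^sub>m n n :: complex mat" and ?I = "1\<^sub>m n :: complex mat"
  let ?M = "four_block_mat (A * B) ?Z B ?Z" and ?N = "four_block_mat ?Z ?Z B (B * A)"
  let ?P = "four_block_mat ?I A ?Z ?I" and ?Q = "four_block_mat ?I (- A) ?Z ?I"
  note [simp] = mult_four_block_mat[of _ n n _ n _ n _ _ n _ n]
  have one: "four_block_mat ?I ?Z ?Z ?I = 1\<^sub>m (n + n)" by (rule four_block_one_mat)
  have lin: "\<exists>es. char_poly C = (\<Prod>a\<leftarrow>es. [:- a, 1:])" if "C \<in> carrier_mat n n" for C :: "complex mat"
    using char_poly_factorized[OF that] by blast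
  have cancel: "C + - C = ?Z" "- C + C = ?Z" if "C \<in> carrier_mat n n" for C
    using that by (auto intro!: eq_matI)
  have neg0: "- ?Z + ?I = ?I" by (rule eq_matI) auto
  have "similar_mat_wit ?M ?N ?P ?Q"
  proof (rule similar_mat_witI[of _ _ "n + n"])
    show "?P * ?Q = 1\<^sub>m (n + n)" "?Q * ?P = 1\<^sub>m (n + n)"
      using A cancel[OF A] neg0 by (simp_all add: one)
    have "A * B * A + - (A * (B * A)) = ?Z" 
      using A B cancel[of "A * (B * A)"] by (simp add: assoc_mult_mat[of _ n n _ n _ n])
    then show "?M = ?P * ?N * ?Q"
      using A B by (simp add: uminus_mult_right_mat cancel mult_carrier_mat[of _ n n _ n])
  qed (use A B in auto)
  then have "char_poly ?M = char_poly ?N"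
    by (intro char_poly_similar) (auto simp: similar_mat_def)
  moreover have "char_poly ?M = char_poly (A * B) * char_poly ?Z"
    by (rule char_poly_0_block'[OF refl lin lin]) (use A B in auto)
  moreover have "char_poly ?N = char_poly ?Z * char_poly (B * A)"
    by (rule char_poly_0_block'[OF refl lin lin]) (use A B in auto)
  moreover have "char_poly ?Z \<noteq> 0"
    using degree_monic_char_poly[of ?Z n] by auto
  ultimately show ?thesis by simp
qed

section \<open>Traces of two-sided products in eigenbases\<close>

text \<open>Both unitary changes of basis are absorbed into \<open>Z = U\<^sup>* Y V\<close>, since the trace is cyclic: what
  remains is \<open>tr (D Z E Z\<^sup>*)\<close> with \<open>D\<close> and \<open>E\<close> diagonal.\<close>

lemma weighted_trace:
  fixes P Q Y :: "complex mat"
  assumes carr: "P \<in> carrier_mat n n" "Q \<in> carrier_mat n n" "Y \<in> carrier_mat n n"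
    and P: "similar_mat_wit P (mat_diag n d) U (mat_adjoint U)"
    and Q: "similar_mat_wit Q (mat_diag n e) V (mat_adjoint V)"
  shows "mat_trace (P * Y * Q * mat_adjoint Y) =
    (\<Sum>i<n. \<Sum>j<n. d i * e j * of_real ((cmod ((mat_adjoint U * Y * V) $$ (i, j)))\<^sup>2))"
proof -
  note p = similar_mat_witD2[OF carr(1) P] and q = similar_mat_witD2[OF carr(2) Q]
  note sq = square_mat_simps[where n = n]
  define Z where "Z = mat_adjoint U * Y * V"
  let ?D = "mat_diag n d" and ?E = "mat_diag n e"
  have Z: "Z \<in> carrier_mat n n" unfolding Z_def using carr p(6) q(6) by (simp add: sq)
  have adjZ: "mat_adjoint Z = mat_adjoint V * mat_adjoint Y * U"
    unfolding Z_def using carr p(6) q(6) by (simp add: square_mat_simps[where n = n])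
  have "P * Y * Q * mat_adjoint Y = U * (?D * Z * ?E * (mat_adjoint V * mat_adjoint Y))"
    unfolding p(3) q(3) Z_def using carr(3) p(6) q(6) by (simp add: sq)
  also have "mat_trace \<dots> = mat_trace (?D * Z * ?E * (mat_adjoint V * mat_adjoint Y) * U)"
    using Z carr(3) p(6) q(6)
    by (intro mat_trace_comm[of _ n n]) (auto simp: mult_carrier_mat[of _ n n _ n])
  also have "?D * Z * ?E * (mat_adjoint V * mat_adjoint Y) * U = ?D * Z * (?E * mat_adjoint Z)"
    unfolding adjZ using Z carr(3) p(6) q(6) by (simp add: sq)
  also have "mat_trace \<dots> = (\<Sum>i<n. \<Sum>j<n. d i * e j * of_real ((cmod (Z $$ (i, j)))\<^sup>2))"
    using Z by (subst mat_trace_mult[of _ n n])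
      (auto simp: mat_diag_mult_left[of _ n n] complex_norm_square mult_ac
        simp del: of_real_power intro!: sum.cong)
  finally show ?thesis unfolding Z_def .
qed

lemma unitary_similar_one:
  fixes P :: "complex mat"
  assumes "P \<in> carrier_mat n n" "similar_mat_wit P D U (mat_adjoint U)"
  shows "similar_mat_wit (1\<^sub>m n) (mat_diag n (\<lambda>_. 1)) U (mat_adjoint U)"
  using similar_mat_witD2[OF assms] by (intro similar_mat_witI[of _ _ n]) auto

text \<open>The case of \<open>weighted_trace\<close> with all weights one, since the identity is diagonal in every
  orthonormal basis: the weights \<open>|(U\<^sup>* Y V)\<^sub>i\<^sub>j|\<^sup>2\<close> have total \<open>\<parallel>Y\<parallel>\<^sup>2\<close>.\<close>

lemma frobenius_sq_unitary:
  fixes P Q Y :: "complex mat"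
  assumes carr: "P \<in> carrier_mat n n" "Q \<in> carrier_mat n n" "Y \<in> carrier_mat n n"
    and P: "similar_mat_wit P D U (mat_adjoint U)"
    and Q: "similar_mat_wit Q E V (mat_adjoint V)"
  shows "frobenius_sq Y = (\<Sum>i<n. \<Sum>j<n. (cmod ((mat_adjoint U * Y * V) $$ (i, j)))\<^sup>2)"
proof -
  have "complex_of_real (frobenius_sq Y) = mat_trace (1\<^sub>m n * Y * 1\<^sub>m n * mat_adjoint Y)"
    using carr(3) by (simp add: frobenius_sq_trace)
  also have "\<dots> = of_real (\<Sum>i<n. \<Sum>j<n. (cmod ((mat_adjoint U * Y * V) $$ (i, j)))\<^sup>2)"
    using weighted_trace[OF _ _ carr(3) unitary_similar_one[OF carr(1) P] unitary_similar_one[OF carr(2) Q]]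
    by (simp del: left_mult_one_mat right_mult_one_mat)
  finally show ?thesis unfolding of_real_eq_iff .
qed

lemma trace_square:
  fixes P :: "complex mat"
  assumes P: "P \<in> carrier_mat n n" and sim: "similar_mat_wit P (mat_diag n d) U (mat_adjoint U)"
  shows "mat_trace P = (\<Sum>i<n. d i)" "mat_trace (P * P) = (\<Sum>i<n. (d i)\<^sup>2)"
proof -
  note p = similar_mat_witD2[OF P sim]
  have *: "mat_trace (Q * P) = (\<Sum>i<n. e i * d i)"
    if "similar_mat_wit Q (mat_diag n e) U (mat_adjoint U)" "Q \<in> carrier_mat n n" for Q e
  proof -
    have "mat_trace (Q * P) = mat_trace (Q * 1\<^sub>m n * P * mat_adjoint (1\<^sub>m n))"
      using P that(2) by simp
    also have "\<dots> = (\<Sum>i<n. \<Sum>j<n. if i = j then e i * d j else 0)"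
      unfolding weighted_trace[OF that(2) P one_carrier_mat that(1) sim]
      using p by (intro sum.cong refl) auto
    finally show ?thesis by simp
  qed
  from *[OF unitary_similar_one[OF P sim]] show "mat_trace P = (\<Sum>i<n. d i)"
    using P by simp
  from *[OF sim P] show "mat_trace (P * P) = (\<Sum>i<n. (d i)\<^sup>2)"
    by (simp add: power2_eq_square)
qed

section \<open>The self-adjoint map \<open>T_map X\<close> and its eigenspaces\<close>

lemma commutator_carrier [simp]:
  "X \<in> carrier_mat n n \<Longrightarrow> Y \<in> carrier_mat n n \<Longrightarrow> commutator X Y \<in> carrier_mat n n"
  unfolding commutator_def by auto

lemma mat_adjoint_commutator:
  fixes X Y :: "complex mat"
  assumes "X \<in> carrier_mat n n" "Y \<in> carrier_mat n n"
  shows "mat_adjoint (commutator X Y) = commutator (mat_adjoint Y) (mat_adjoint X)"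
  using assms unfolding commutator_def
  by (simp add: square_mat_simps[where n = n])

text \<open>With respect to the trace inner product, taking the commutator with \<open>X\<^sup>*\<close> is adjoint to taking the
  commutator with \<open>X\<close>. Hence \<open>T_map X\<close> is self-adjoint and positive semidefinite.\<close>

lemma trace_commutator_adjoint:
  fixes X Y C :: "complex mat"
  assumes X: "X \<in> carrier_mat n n" and C: "C \<in> carrier_mat n n" and Z: "Z \<in> carrier_mat n n"
  shows "mat_trace (commutator (mat_adjoint X) C * mat_adjoint Z) =
    mat_trace (C * mat_adjoint (commutator X Z))"
proof -
  note sq = square_mat_simps[where n = n]
  have "mat_trace (mat_adjoint X * (C * mat_adjoint Z)) = mat_trace (C * mat_adjoint Z * mat_adjoint X)"
    using assms by (intro mat_trace_comm[of _ n n]) auto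
  then show ?thesis
    unfolding mat_adjoint_commutator[OF X Z] commutator_def using assms
    by (simp add: square_mat_simps[where n = n])
qed

lemma T_map_carrier [simp]:
  "X \<in> carrier_mat n n \<Longrightarrow> Y \<in> carrier_mat n n \<Longrightarrow> T_map X Y \<in> carrier_mat n n"
  unfolding T_map_def by auto

lemma trace_T_map:
  assumes "X \<in> carrier_mat n n" "Y \<in> carrier_mat n n" "Z \<in> carrier_mat n n"
  shows "mat_trace (T_map X Y * mat_adjoint Z) =
    mat_trace (commutator X Y * mat_adjoint (commutator X Z))"
  unfolding T_map_def using assms by (intro trace_commutator_adjoint) auto

lemma T_map_eigenvectors_orthogonal:
  assumes X: "X \<in> carrier_mat n n" and Y: "Y \<in> carrier_mat n n" and Z: "Z \<in> carrier_mat n n"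
    and eY: "T_map X Y = of_real s \<cdot>\<^sub>m Y" and eZ: "T_map X Z = of_real t \<cdot>\<^sub>m Z" and "s \<noteq> t"
  shows "mat_trace (Y * mat_adjoint Z) = 0"
proof -
  let ?C = "commutator X"
  have C: "?C Y \<in> carrier_mat n n" "?C Z \<in> carrier_mat n n" using X Y Z by auto
  have tr: "mat_trace (P * mat_adjoint Q) = cnj (mat_trace (Q * mat_adjoint P))"
    if "P \<in> carrier_mat n n" "Q \<in> carrier_mat n n" for P Q
    using mat_trace_adjoint[of "Q * mat_adjoint P" n] that
    by (simp add: square_mat_simps[where n = n])
  have "of_real s * mat_trace (Y * mat_adjoint Z) = mat_trace (?C Y * mat_adjoint (?C Z))"
    using trace_T_map[OF X Y Z] Y Z unfolding eY
    by (simp add: square_mat_simps[where n = n])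
  also have "\<dots> = cnj (mat_trace (?C Z * mat_adjoint (?C Y)))" using tr[OF C] .
  also have "mat_trace (?C Z * mat_adjoint (?C Y)) = of_real t * mat_trace (Z * mat_adjoint Y)"
    using trace_T_map[OF X Z Y] Y Z unfolding eZ
    by (simp add: square_mat_simps[where n = n])
  also have "cnj \<dots> = of_real t * mat_trace (Y * mat_adjoint Z)" using tr[OF Y Z] by simp
  finally show ?thesis using \<open>s \<noteq> t\<close> by simp
qed

text \<open>For each \<open>j\<close>, Bessel's inequality for the unit vector at \<open>j\<close> says that the squared \<open>j\<close>-th
  coordinates of the orthonormal vectors sum to \<open>q j \<le> 1\<close>. Summing this over \<open>j\<close> gives the claim,
  as every vector has norm one.\<close>

lemma card_orthonormal_le:
  fixes f :: "'k \<Rightarrow> 'i \<Rightarrow> complex"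
  assumes S: "finite S" and I: "finite I"
    and orth: "\<And>k l. k \<in> S \<Longrightarrow> l \<in> S \<Longrightarrow>
      (\<Sum>i\<in>I. f k i * cnj (f l i)) = (if k = l then 1 else 0)"
  shows "card S \<le> card I"
proof -
  define q where "q j = (\<Sum>k\<in>S. (cmod (f k j))\<^sup>2)" for j
  have q: "q j \<le> 1" if j: "j \<in> I" for j
  proof -
    \<comment> \<open>\<open>p\<close> is the orthogonal projection of the unit vector at \<open>j\<close> onto the span of the \<open>f k\<close>; its
      squared norm and its \<open>j\<close>-th coordinate are both \<open>q j\<close>, so \<open>(q j)\<^sup>2 \<le> q j\<close>.\<close>
    define p where "p i = (\<Sum>k\<in>S. cnj (f k j) * f k i)" for i
    have pj: "p j = of_real (q j)"
      unfolding p_def q_def of_real_sum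
      by (intro sum.cong refl) (simp add: complex_norm_square mult.commute del: of_real_power)
    have "of_real (\<Sum>i\<in>I. (cmod (p i))\<^sup>2) = (\<Sum>i\<in>I. p i * cnj (p i))"
      by (simp add: complex_norm_square del: of_real_power)
    also have "\<dots> = (\<Sum>i\<in>I. \<Sum>k\<in>S. \<Sum>l\<in>S. cnj (f k j) * f l j * (f k i * cnj (f l i)))"
      unfolding p_def cnj_sum sum_product by (intro sum.cong refl) (simp add: mult_ac)
    also have "\<dots> = (\<Sum>k\<in>S. \<Sum>i\<in>I. \<Sum>l\<in>S. cnj (f k j) * f l j * (f k i * cnj (f l i)))"
      by (rule sum.swap)
    also have "\<dots> = (\<Sum>k\<in>S. \<Sum>l\<in>S. cnj (f k j) * f l j * (\<Sum>i\<in>I. f k i * cnj (f l i)))"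
      by (rule sum.cong[OF refl], subst sum.swap) (simp add: sum_distrib_left)
    also have "\<dots> = (\<Sum>k\<in>S. \<Sum>l\<in>S. if k = l then cnj (f k j) * f l j else 0)"
      by (intro sum.cong refl) (simp add: orth)
    also have "\<dots> = p j" unfolding p_def using S by simp
    finally have "(\<Sum>i\<in>I. (cmod (p i))\<^sup>2) = q j" unfolding pj of_real_eq_iff .
    moreover have "(cmod (p j))\<^sup>2 \<le> (\<Sum>i\<in>I. (cmod (p i))\<^sup>2)"
      using I j by (intro member_le_sum) auto
    ultimately have "(q j)\<^sup>2 \<le> q j" unfolding pj by simp
    then show ?thesis
      using self_le_power[of "q j" 2] power_strict_increasing[of 1 2 "q j"] by fastforce
  qed
  have one: "(\<Sum>j\<in>I. (cmod (f k j))\<^sup>2) = 1" if "k \<in> S" for k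
  proof -
    have "of_real (\<Sum>j\<in>I. (cmod (f k j))\<^sup>2) = (\<Sum>i\<in>I. f k i * cnj (f k i))"
      by (simp add: complex_norm_square del: of_real_power)
    then show ?thesis using orth[OF that that] by (metis of_real_eq_1_iff)
  qed
  have "real (card S) = (\<Sum>k\<in>S. \<Sum>j\<in>I. (cmod (f k j))\<^sup>2)" by (simp add: one)
  also have "\<dots> = (\<Sum>j\<in>I. q j)" unfolding q_def by (rule sum.swap)
  also have "\<dots> \<le> (\<Sum>j\<in>I. 1)" by (intro sum_mono q)
  finally show ?thesis by simp
qed

text \<open>Normalized eigenvectors for distinct eigenvalues are orthonormal in a space of dimension \<open>n\<^sup>2\<close>.\<close>

lemma finite_real_eigenvalues_T_map:
  assumes X: "X \<in> carrier_mat n n"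
  shows "finite {t. mat_map_eigenvalue n (T_map X) (complex_of_real t)}" (is "finite ?E")
proof (rule ccontr)
  assume "infinite ?E"
  then obtain S where S: "finite S" "card S = Suc (n * n)" "S \<subseteq> ?E"
    using infinite_arbitrarily_large by blast
  have "\<forall>t\<in>S. \<exists>Y. Y \<in> carrier_mat n n \<and> Y \<noteq> 0\<^sub>m n n \<and> T_map X Y = complex_of_real t \<cdot>\<^sub>m Y"
    using S(3) unfolding mat_map_eigenvalue_def by blast
  then obtain g where "\<forall>t\<in>S. g t \<in> carrier_mat n n \<and> g t \<noteq> 0\<^sub>m n n \<and>
      T_map X (g t) = complex_of_real t \<cdot>\<^sub>m g t" by (rule bchoice[THEN exE])
  then have g: "g t \<in> carrier_mat n n" "g t \<noteq> 0\<^sub>m n n" "T_map X (g t) = complex_of_real t \<cdot>\<^sub>m g t"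
    if "t \<in> S" for t using that by blast+
  define r where "r t = sqrt (frobenius_sq (g t))" for t
  define f where "f t = (\<lambda>(i, j). g t $$ (i, j) / of_real (r t))" for t
  have "card S \<le> card ({..<n} \<times> {..<n})"
  proof (rule card_orthonormal_le[of _ _ f])
    fix s t assume st: "s \<in> S" "t \<in> S"
    have pos: "0 < frobenius_sq (g s)" using frobenius_sq_pos[OF g(1,2)] st by blast
    have "(\<Sum>p\<in>{..<n} \<times> {..<n}. f s p * cnj (f t p)) =
        mat_trace (g s * mat_adjoint (g t)) / of_real (r s * r t)"
      using g(1)[OF st(1)] g(1)[OF st(2)]
      by (subst mat_trace_mult[of _ n n])
        (auto simp: f_def case_prod_beta sum.cartesian_product sum_divide_distrib intro!: sum.cong)
    also have "\<dots> = (if s = t then 1 else 0)"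
      using T_map_eigenvectors_orthogonal[OF X g(1) g(1) g(3) g(3)] st pos
        frobenius_sq_trace[OF g(1)[OF st(1)]]
      by (auto simp: r_def simp flip: of_real_mult)
    finally show "(\<Sum>p\<in>{..<n} \<times> {..<n}. f s p * cnj (f t p)) = (if s = t then 1 else 0)" .
  qed (use S in auto)
  then show False using S(2) by simp
qed

text \<open>Write \<open>C = [X, Y]\<close>. The adjoint of \<open>[X\<^sup>*, C] = t Y\<close> reads \<open>[X, C\<^sup>*] = - t Y\<^sup>*\<close>, and taking the
  commutator of \<open>X\<^sup>*\<close> with this gives \<open>- t [X\<^sup>*, Y\<^sup>*] = t C\<^sup>*\<close>. The trace identity says that
  \<open>Y\<close> and \<open>C\<^sup>*\<close> are orthogonal, so that the eigenspace of a nonzero \<open>t\<close> is at least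
  two-dimensional.\<close>

lemma T_map_adjoint_commutator_eigenvector:
  assumes X: "X \<in> carrier_mat n n" and Y: "Y \<in> carrier_mat n n" and ev: "T_map X Y = of_real t \<cdot>\<^sub>m Y"
  shows "T_map X (mat_adjoint (commutator X Y)) = of_real t \<cdot>\<^sub>m mat_adjoint (commutator X Y)"
    and "mat_trace (Y * commutator X Y) = 0"
proof -
  let ?C = "commutator X Y"
  have C: "?C \<in> carrier_mat n n" using X Y by simp
  have swap: "commutator P Q = - commutator Q P" if "P \<in> carrier_mat n n" "Q \<in> carrier_mat n n" for P Q :: "complex mat"
    unfolding commutator_def using that by (intro eq_matI) auto
  have "commutator (mat_adjoint ?C) X = of_real t \<cdot>\<^sub>m mat_adjoint Y"
    using arg_cong[OF ev, of mat_adjoint] mat_adjoint_commutator[of "mat_adjoint X" n ?C] X C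
    by (simp add: T_map_def mat_adjoint_smult)
  then have "commutator X (mat_adjoint ?C) = - (of_real t \<cdot>\<^sub>m mat_adjoint Y)"
    using swap[of X "mat_adjoint ?C"] X C by simp
  also have "commutator (mat_adjoint X) \<dots> = of_real t \<cdot>\<^sub>m commutator (mat_adjoint Y) (mat_adjoint X)"
    unfolding commutator_def using X Y
    by (intro eq_matI) (auto simp: scalar_prod_def sum_distrib_left sum_negf algebra_simps)
  finally show "T_map X (mat_adjoint ?C) = of_real t \<cdot>\<^sub>m mat_adjoint ?C"
    unfolding T_map_def mat_adjoint_commutator[OF X Y] .
  have "mat_trace (Y * (Y * X)) = mat_trace (Y * X * Y)"
    using X Y by (intro mat_trace_comm[of _ n n]) auto
  then show "mat_trace (Y * ?C) = 0"
    unfolding commutator_def using X Y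
    by (simp add: square_mat_simps[where n = n])
qed

text \<open>On the span of \<open>Y\<close> and \<open>[X, Y]\<^sup>*\<close> the entry \<open>(P Y Q)\<^sub>0\<^sub>0\<close> is a linear functional, and a linear
  functional on a two-dimensional space has a nonzero kernel.\<close>

lemma T_map_eigenvector_in_hyperplane:
  assumes X: "X \<in> carrier_mat n n" and "t \<noteq> 0"
    and ev: "mat_map_eigenvalue n (T_map X) (complex_of_real t)"
    and P: "P \<in> carrier_mat n n" and Q: "Q \<in> carrier_mat n n" and n: "0 < n"
  obtains Y where "Y \<in> carrier_mat n n" "Y \<noteq> 0\<^sub>m n n" "T_map X Y = of_real t \<cdot>\<^sub>m Y"
    "(P * Y * Q) $$ (0, 0) = 0"
proof -
  note sq = square_mat_simps[where n = n]
  from ev obtain Y where Y: "Y \<in> carrier_mat n n" "Y \<noteq> 0\<^sub>m n n" "T_map X Y = of_real t \<cdot>\<^sub>m Y"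
    unfolding mat_map_eigenvalue_def by blast
  define W where "W = mat_adjoint (commutator X Y)"
  have W: "W \<in> carrier_mat n n" using X Y unfolding W_def by simp
  have TW: "T_map X W = of_real t \<cdot>\<^sub>m W"
    unfolding W_def by (rule T_map_adjoint_commutator_eigenvector(1)[OF X Y(1,3)])
  have orth: "mat_trace (Y * mat_adjoint W) = 0"
    unfolding W_def using T_map_adjoint_commutator_eigenvector(2)[OF X Y(1,3)] by simp
  have "W \<noteq> 0\<^sub>m n n"
  proof
    assume "W = 0\<^sub>m n n"
    then have "mat_adjoint W = 0\<^sub>m n n" by (auto intro!: eq_matI)
    then have "commutator X Y = 0\<^sub>m n n" unfolding W_def by simp
    then have "T_map X Y = 0\<^sub>m n n" unfolding T_map_def commutator_def[of "mat_adjoint X"] using X by simp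
    then have "of_real t * Y $$ (i, j) = 0" if "i < n" "j < n" for i j
      using Y that by (metis carrier_matD index_smult_mat(1) index_zero_mat(1))
    then have "Y = 0\<^sub>m n n" using Y(1) \<open>t \<noteq> 0\<close> by (intro eq_matI) auto
    with Y(2) show False ..
  qed
  define p q where "p = (P * Y * Q) $$ (0, 0)" and "q = (P * W * Q) $$ (0, 0)"
  show thesis
  proof (cases "q = 0")
    case True
    with that W TW \<open>W \<noteq> 0\<^sub>m n n\<close> show thesis unfolding q_def by blast
  next
    case False
    \<comment> \<open>The combination on which the functional vanishes; it is nonzero because its inner product with \<open>Y\<close>
      is \<open>q \<parallel>Y\<parallel>\<^sup>2\<close>.\<close>
    define Z where "Z = q \<cdot>\<^sub>m Y - p \<cdot>\<^sub>m W"
    have Z: "Z \<in> carrier_mat n n" unfolding Z_def using W Y by (simp add: sq)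
    have "commutator C (q \<cdot>\<^sub>m D - p \<cdot>\<^sub>m E) = q \<cdot>\<^sub>m commutator C D - p \<cdot>\<^sub>m commutator C E"
      if "C \<in> carrier_mat n n" "D \<in> carrier_mat n n" "E \<in> carrier_mat n n" for C D E
      unfolding commutator_def using that by (intro eq_matI) (auto simp: sq algebra_simps)
    then have "T_map X Z = q \<cdot>\<^sub>m T_map X Y - p \<cdot>\<^sub>m T_map X W"
      unfolding T_map_def Z_def using X Y W by simp
    also have "\<dots> = of_real t \<cdot>\<^sub>m Z"
      unfolding Y(3) TW Z_def using W Y(1) by (intro eq_matI) (auto simp: algebra_simps)
    finally have TZ: "T_map X Z = of_real t \<cdot>\<^sub>m Z" .
    have "P * Z * Q = q \<cdot>\<^sub>m (P * Y * Q) - p \<cdot>\<^sub>m (P * W * Q)"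
      unfolding Z_def using P Q Y(1) W by (simp add: sq)
    then have 0: "(P * Z * Q) $$ (0, 0) = 0" using n P Q Y(1) W by (simp add: p_def q_def)
    have "mat_trace (Z * mat_adjoint Y) = q * mat_trace (Y * mat_adjoint Y) - p * mat_trace (W * mat_adjoint Y)"
      unfolding Z_def using Y(1) W by (simp add: sq)
    also have "mat_trace (W * mat_adjoint Y) = 0"
      using mat_trace_adjoint[of "Y * mat_adjoint W" n] orth Y(1) W by (simp add: sq)
    finally have "mat_trace (Z * mat_adjoint Y) \<noteq> 0"
      using False frobenius_sq_trace[OF Y(1)] frobenius_sq_pos[OF Y(1,2)] by simp
    then have "Z \<noteq> 0\<^sub>m n n" using Y(1) by (auto simp: mat_trace_def)
    with that Z TZ 0 show thesis by blast
  qed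
qed

lemma frobenius_sq_commutator_eigenvector:
  assumes X: "X \<in> carrier_mat n n" and Y: "Y \<in> carrier_mat n n" and ev: "T_map X Y = of_real t \<cdot>\<^sub>m Y"
  shows "frobenius_sq (commutator X Y) = t * frobenius_sq Y"
proof -
  have "complex_of_real (frobenius_sq (commutator X Y)) = mat_trace (T_map X Y * mat_adjoint Y)"
    unfolding trace_T_map[OF X Y Y] using X Y by (simp add: frobenius_sq_trace[of _ n n])
  also have "\<dots> = of_real (t * frobenius_sq Y)"
    unfolding ev using Y by (simp add: square_mat_simps[where n = n] frobenius_sq_trace[of _ n n])
  finally show ?thesis unfolding of_real_eq_iff .
qed

text \<open>Together with \<open>finite_real_eigenvalues_T_map\<close> this makes the maximum that defines \<open>lambda1_T\<close>
  attained: the identity matrix commutes with \<open>X\<close>.\<close>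

lemma T_map_zero_eigenvalue:
  assumes "X \<in> carrier_mat n n" "0 < n"
  shows "mat_map_eigenvalue n (T_map X) 0"
proof -
  have "T_map X (1\<^sub>m n) = 0 \<cdot>\<^sub>m 1\<^sub>m n"
    unfolding T_map_def commutator_def using assms by (auto intro!: eq_matI)
  moreover have "1\<^sub>m n \<noteq> (0\<^sub>m n n :: complex mat)"
    using assms(2) by (metis index_one_mat(1) index_zero_mat(1) zero_neq_one)
  ultimately show ?thesis unfolding mat_map_eigenvalue_def by (intro bexI[of _ "1\<^sub>m n"]) auto
qed

section \<open>Bounding the norm of a commutator\<close>

text \<open>The factors \<open>1\<^sub>m n\<close> and the cyclic order of the traces are chosen so that every term has the shape
  \<open>tr (P Y Q Y\<^sup>*)\<close> of \<open>weighted_trace\<close>.\<close>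

lemma frobenius_sq_commutator:
  assumes X: "X \<in> carrier_mat n n" and Y: "Y \<in> carrier_mat n n"
  shows "frobenius_sq (commutator X Y) =
    Re (mat_trace (mat_adjoint X * X * Y * 1\<^sub>m n * mat_adjoint Y))
    + Re (mat_trace (1\<^sub>m n * Y * (X * mat_adjoint X) * mat_adjoint Y))
    - 2 * Re (mat_trace (X * Y * mat_adjoint X * mat_adjoint Y))"
proof -
  note sq = square_mat_simps[where n = n]
  let ?X = "mat_adjoint X" and ?Y = "mat_adjoint Y"
  have "complex_of_real (frobenius_sq (commutator X Y)) =
      mat_trace ((X * Y - Y * X) * (?Y * ?X - ?X * ?Y))"
    using frobenius_sq_trace[OF commutator_carrier[OF X Y]]
    unfolding mat_adjoint_commutator[OF X Y] by (simp only: commutator_def)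
  also have "\<dots> = mat_trace (X * (Y * ?Y * ?X)) - mat_trace (X * Y * ?X * ?Y)
      - (mat_trace (Y * X * (?Y * ?X)) - mat_trace (Y * (X * ?X) * ?Y))"
    using X Y by (simp add: square_mat_simps[where n = n])
  also have "mat_trace (X * (Y * ?Y * ?X)) = mat_trace (Y * ?Y * ?X * X)"
    using X Y by (intro mat_trace_comm[of _ n n]) auto
  also have "\<dots> = mat_trace (Y * ?Y * (?X * X))" using X Y by (simp add: sq)
  also have "\<dots> = mat_trace (?X * X * (Y * ?Y))"
    using X Y by (intro mat_trace_comm[of _ n n]) auto
  also have "mat_trace (Y * X * (?Y * ?X)) = cnj (mat_trace (X * Y * ?X * ?Y))"
    using mat_trace_adjoint[of "X * Y * ?X * ?Y" n] X Y
    by (simp add: square_mat_simps[where n = n])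
  finally show ?thesis using X Y by (simp add: complex_eq_iff sq)
qed

text \<open>For \<open>P\<close> Hermitian and \<open>Q\<close> skew-Hermitian, or conversely, the factor \<open>r s = - 1\<close> shows that the
  trace is purely imaginary; this is what removes the mixed terms in \<open>Re_trace_cartesian\<close>.\<close>

lemma cnj_trace_sandwich:
  fixes P Q Y :: "complex mat"
  assumes carr: "P \<in> carrier_mat n n" "Q \<in> carrier_mat n n" "Y \<in> carrier_mat n n"
    and adj: "mat_adjoint P = r \<cdot>\<^sub>m P" "mat_adjoint Q = s \<cdot>\<^sub>m Q"
  shows "cnj (mat_trace (P * Y * Q * mat_adjoint Y)) = r * s * mat_trace (P * Y * Q * mat_adjoint Y)"
proof -
  note sq = square_mat_simps[where n = n]
  have "cnj (mat_trace (P * Y * Q * mat_adjoint Y)) = mat_trace (Y * mat_adjoint Q * mat_adjoint Y * mat_adjoint P)"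
    using mat_trace_adjoint[of "P * Y * Q * mat_adjoint Y" n] carr
    by (simp add: square_mat_simps[where n = n])
  also have "\<dots> = r * s * mat_trace (Y * Q * mat_adjoint Y * P)"
    unfolding adj using carr by (simp add: square_mat_simps[where n = n])
  also have "mat_trace (Y * Q * mat_adjoint Y * P) = mat_trace (P * (Y * Q * mat_adjoint Y))"
    using carr by (intro mat_trace_comm[of _ n n]) auto
  finally show ?thesis using carr by (simp add: sq)
qed

lemma Re_trace_cartesian:
  fixes A B Y :: "complex mat"
  assumes A: "A \<in> carrier_mat n n" "mat_adjoint A = A" and B: "B \<in> carrier_mat n n" "mat_adjoint B = - B"
    and Y: "Y \<in> carrier_mat n n"
  shows "Re (mat_trace ((A + B) * Y * mat_adjoint (A + B) * mat_adjoint Y)) =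
    Re (mat_trace (A * Y * A * mat_adjoint Y)) - Re (mat_trace (B * Y * B * mat_adjoint Y))"
proof -
  have adj: "mat_adjoint A = 1 \<cdot>\<^sub>m A" "mat_adjoint B = (-1) \<cdot>\<^sub>m B"
    using A B by (auto intro!: eq_matI)
  have "Re (mat_trace (A * Y * B * mat_adjoint Y)) = 0" "Re (mat_trace (B * Y * A * mat_adjoint Y)) = 0"
    using cnj_trace_sandwich[OF A(1) B(1) Y adj] cnj_trace_sandwich[OF B(1) A(1) Y adj(2,1)]
    by (auto simp: complex_eq_iff)
  moreover have "mat_adjoint (A + B) = A - B"
    using A B by (subst mat_adjoint_add[of _ n n]) (auto intro!: eq_matI)
  moreover have "mat_trace ((A + B) * Y * (A - B) * mat_adjoint Y) =
      mat_trace (A * Y * A * mat_adjoint Y) - mat_trace (A * Y * B * mat_adjoint Y)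
      + (mat_trace (B * Y * A * mat_adjoint Y) - mat_trace (B * Y * B * mat_adjoint Y))"
    using A(1) B(1) Y by (simp add: square_mat_simps[where n = n])
  ultimately show ?thesis by simp
qed

text \<open>Every trace is a sum of eigenvalue expressions with nonnegative weights of total \<open>\<parallel>Y\<parallel>\<^sup>2\<close>, so each is
  bounded by an extreme coefficient. The coefficient \<open>2 s\<^sub>0\<^sup>2\<close> at the position \<open>(0, 0)\<close> may
  exceed \<open>\<gamma>\<close>, but the last hypothesis gives it weight zero.\<close>

lemma commutator_bound:
  fixes X A B Y U V :: "complex mat" and a b s :: "nat \<Rightarrow> real"
  assumes carr: "A \<in> carrier_mat n n" "B \<in> carrier_mat n n" "Y \<in> carrier_mat n n"
    and X: "X = A + B" and adj: "mat_adjoint A = A" "mat_adjoint B = - B"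
    and A: "similar_mat_wit A (mat_diag n (\<lambda>i. of_real (a i))) UA (mat_adjoint UA)"
    and B: "similar_mat_wit B (mat_diag n (\<lambda>i. of_real (b i) * \<i>)) UB (mat_adjoint UB)"
    and V: "similar_mat_wit (mat_adjoint X * X) (mat_diag n (\<lambda>i. of_real ((s i)\<^sup>2))) V (mat_adjoint V)"
    and U: "similar_mat_wit (X * mat_adjoint X) (mat_diag n (\<lambda>i. of_real ((s i)\<^sup>2))) U (mat_adjoint U)"
    and \<alpha>: "\<And>i j. i < n \<Longrightarrow> j < n \<Longrightarrow> - (a i * a j) \<le> \<alpha>"
    and \<beta>: "\<And>i j. i < n \<Longrightarrow> j < n \<Longrightarrow> - (b i * b j) \<le> \<beta>"
    and \<gamma>: "\<And>i j. i < n \<Longrightarrow> j < n \<Longrightarrow> (i, j) \<noteq> (0, 0) \<Longrightarrow> (s i)\<^sup>2 + (s j)\<^sup>2 \<le> \<gamma>"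
    and zero: "(mat_adjoint V * Y * U) $$ (0, 0) = 0"
  shows "frobenius_sq (commutator X Y) \<le> (2 * (\<alpha> + \<beta>) + \<gamma>) * frobenius_sq Y"
proof -
  have Xc: "X \<in> carrier_mat n n" using X carr by simp
  have S: "mat_adjoint X * X \<in> carrier_mat n n" "X * mat_adjoint X \<in> carrier_mat n n"
    using Xc by auto
  define zA zB z where "zA i j = (cmod ((mat_adjoint UA * Y * UA) $$ (i, j)))\<^sup>2"
    and "zB i j = (cmod ((mat_adjoint UB * Y * UB) $$ (i, j)))\<^sup>2"
    and "z i j = (cmod ((mat_adjoint V * Y * U) $$ (i, j)))\<^sup>2" for i j
  have frob: "frobenius_sq Y = (\<Sum>i<n. \<Sum>j<n. zA i j)" "frobenius_sq Y = (\<Sum>i<n. \<Sum>j<n. zB i j)"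
    "frobenius_sq Y = (\<Sum>i<n. \<Sum>j<n. z i j)"
    unfolding zA_def zB_def z_def
    using frobenius_sq_unitary[OF carr(1,1,3) A A] frobenius_sq_unitary[OF carr(2,2,3) B B]
      frobenius_sq_unitary[OF S carr(3) V U] .
  have "- Re (mat_trace (A * Y * A * mat_adjoint Y)) = (\<Sum>i<n. \<Sum>j<n. - (a i * a j) * zA i j)"
    unfolding weighted_trace[OF carr(1,1,3) A A] zA_def by (simp add: sum_negf)
  also have "\<dots> \<le> (\<Sum>i<n. \<Sum>j<n. \<alpha> * zA i j)"
    by (intro sum_mono mult_right_mono \<alpha>) (auto simp: zA_def)
  also have "\<dots> = \<alpha> * frobenius_sq Y" unfolding frob(1) by (simp add: sum_distrib_left)
  finally have 1: "- Re (mat_trace (A * Y * A * mat_adjoint Y)) \<le> \<alpha> * frobenius_sq Y" .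
  have "Re (mat_trace (B * Y * B * mat_adjoint Y)) = (\<Sum>i<n. \<Sum>j<n. - (b i * b j) * zB i j)"
    unfolding weighted_trace[OF carr(2,2,3) B B] zB_def by (simp add: sum_negf)
  also have "\<dots> \<le> (\<Sum>i<n. \<Sum>j<n. \<beta> * zB i j)"
    by (intro sum_mono mult_right_mono \<beta>) (auto simp: zB_def)
  also have "\<dots> = \<beta> * frobenius_sq Y" unfolding frob(2) by (simp add: sum_distrib_left)
  finally have 2: "Re (mat_trace (B * Y * B * mat_adjoint Y)) \<le> \<beta> * frobenius_sq Y" .
  have "Re (mat_trace (mat_adjoint X * X * Y * 1\<^sub>m n * mat_adjoint Y))
      + Re (mat_trace (1\<^sub>m n * Y * (X * mat_adjoint X) * mat_adjoint Y))
      = (\<Sum>i<n. \<Sum>j<n. ((s i)\<^sup>2 + (s j)\<^sup>2) * z i j)"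
    unfolding weighted_trace[OF S(1) one_carrier_mat carr(3) V unitary_similar_one[OF S(2) U]]
      weighted_trace[OF one_carrier_mat S(2) carr(3) unitary_similar_one[OF S(1) V] U] z_def
    by (simp add: sum.distrib distrib_right)
  also have "\<dots> \<le> (\<Sum>i<n. \<Sum>j<n. \<gamma> * z i j)"
  proof (intro sum_mono)
    fix i j assume ij: "i \<in> {..<n}" "j \<in> {..<n}"
    show "((s i)\<^sup>2 + (s j)\<^sup>2) * z i j \<le> \<gamma> * z i j"
    proof (cases "(i, j) = (0, 0)")
      case True
      then show ?thesis using zero by (simp add: z_def)
    next
      case False
      then show ?thesis using ij by (intro mult_right_mono \<gamma>) (auto simp: z_def)
    qed
  qed
  also have "\<dots> = \<gamma> * frobenius_sq Y" unfolding frob(3) by (simp add: sum_distrib_left)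
  finally have 3: "Re (mat_trace (mat_adjoint X * X * Y * 1\<^sub>m n * mat_adjoint Y))
      + Re (mat_trace (1\<^sub>m n * Y * (X * mat_adjoint X) * mat_adjoint Y)) \<le> \<gamma> * frobenius_sq Y" .
  have "Re (mat_trace (X * Y * mat_adjoint X * mat_adjoint Y)) =
      Re (mat_trace (A * Y * A * mat_adjoint Y)) - Re (mat_trace (B * Y * B * mat_adjoint Y))"
    unfolding X by (rule Re_trace_cartesian[OF carr(1) adj(1) carr(2) adj(2) carr(3)])
  then show ?thesis
    unfolding frobenius_sq_commutator[OF Xc carr(3)] using 1 2 3 by (simp add: algebra_simps)
qed

section \<open>The eigenvalue estimate\<close>

lemma neg_prod_le_sum_squares:
  fixes a :: "nat \<Rightarrow> real"
  assumes "i \<in> I" "j \<in> I" "finite I"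
  shows "2 * - (a i * a j) \<le> (\<Sum>i\<in>I. (a i)\<^sup>2)"
proof (cases "i = j")
  case True
  then have "2 * - (a i * a j) \<le> 0" by simp
  also have "\<dots> \<le> (\<Sum>i\<in>I. (a i)\<^sup>2)" by (simp add: sum_nonneg)
  finally show ?thesis .
next
  case False
  have "0 \<le> (a i + a j)\<^sup>2" by simp
  then have "2 * - (a i * a j) \<le> (\<Sum>i\<in>{i, j}. (a i)\<^sup>2)"
    using False by (simp add: power2_sum)
  also have "\<dots> \<le> (\<Sum>i\<in>I. (a i)\<^sup>2)" using assms by (intro sum_mono2) auto
  finally show ?thesis .
qed

text \<open>This is \<open>Re_trace_cartesian\<close> for \<open>Y\<close> the identity. As \<open>B\<^sup>* = - B\<close>, the subtracted trace is
  \<open>- \<parallel>B\<parallel>\<^sup>2\<close>.\<close>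

lemma frobenius_sq_cartesian:
  assumes A: "A \<in> carrier_mat n n" "mat_adjoint A = A" and B: "B \<in> carrier_mat n n" "mat_adjoint B = - B"
  shows "frobenius_sq (A + B) = Re (mat_trace (A * A)) - Re (mat_trace (B * B))"
proof -
  have "complex_of_real (frobenius_sq (A + B)) = mat_trace ((A + B) * 1\<^sub>m n * mat_adjoint (A + B) * mat_adjoint (1\<^sub>m n))"
    using A B by (simp add: frobenius_sq_trace[of _ n n])
  then have "frobenius_sq (A + B) = Re (mat_trace ((A + B) * 1\<^sub>m n * mat_adjoint (A + B) * mat_adjoint (1\<^sub>m n)))"
    by (metis Re_complex_of_real)
  also have "\<dots> = Re (mat_trace (A * A)) - Re (mat_trace (B * B))"
    using Re_trace_cartesian[OF A B one_carrier_mat] A B by simp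
  finally show ?thesis .
qed

theorem theorem3p1:
  fixes n :: nat and X A B :: "complex mat" and a b \<sigma> :: "nat \<Rightarrow> real"
  assumes "n \<ge> 2"
    and "X \<in> carrier_mat n n" and "frobenius_norm X = 1"
    and "A \<in> carrier_mat n n" and "B \<in> carrier_mat n n"
    and "X = A + B" and "hermitian_mat A" and "skew_hermitian_mat B"
    and "ordered_singular_values X n \<sigma>"
    and "enumerates_eigenvalues A n (\<lambda>i. complex_of_real (a i))"
    and "enumerates_eigenvalues B n (\<lambda>j. complex_of_real (b j) * \<i>)"
  shows "lambda1_T X
           \<le> 2 * (Max {- (a i * a j) | i j. i \<in> {1..n} \<and> j \<in> {1..n}}
                + Max {- (b i * b j) | i j. i \<in> {1..n} \<and> j \<in> {1..n}})
             + ((\<sigma> 1)\<^sup>2 + (\<sigma> 2)\<^sup>2)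
       \<and> 2 * (Max {- (a i * a j) | i j. i \<in> {1..n} \<and> j \<in> {1..n}}
                + Max {- (b i * b j) | i j. i \<in> {1..n} \<and> j \<in> {1..n}})
             + ((\<sigma> 1)\<^sup>2 + (\<sigma> 2)\<^sup>2)
           \<le> 2"
proof -
  note n = assms(1) and X = assms(2) and A = assms(4) and B = assms(5) and XAB = assms(6)
  have adjA: "mat_adjoint A = A" using assms(7) unfolding hermitian_mat_def .
  have adjB: "mat_adjoint B = - B" using assms(8) unfolding skew_hermitian_mat_def .
  let ?prods = "\<lambda>c :: nat \<Rightarrow> real. {- (c i * c j) | i j. i \<in> {1..n} \<and> j \<in> {1..n}}"
  have prods: "?prods c = (\<lambda>(i, j). - (c i * c j)) ` ({1..n} \<times> {1..n})" for c
    by fastforce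
  define \<alpha> \<beta> \<gamma> where "\<alpha> = Max (?prods a)" and "\<beta> = Max (?prods b)"
    and "\<gamma> = (\<sigma> 1)\<^sup>2 + (\<sigma> 2)\<^sup>2"
  have fin: "finite (?prods c)" and ne: "?prods c \<noteq> {}" for c
    unfolding prods using n by auto
  have \<alpha>: "- (a (Suc i) * a (Suc j)) \<le> \<alpha>" if "i < n" "j < n" for i j
    unfolding \<alpha>_def using that by (intro Max_ge[OF fin]) force
  have \<beta>: "- (b (Suc i) * b (Suc j)) \<le> \<beta>" if "i < n" "j < n" for i j
    unfolding \<beta>_def using that by (intro Max_ge[OF fin]) force

  \<comment> \<open>Eigenvalues and singular values are numbered from \<open>1\<close>, matrix entries from \<open>0\<close>; hence the
    shift by \<open>Suc\<close>.\<close>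
  have "mat_adjoint A = 1 \<cdot>\<^sub>m A" unfolding adjA by (auto intro!: eq_matI)
  from unitary_diagonalization[OF A this assms(10)[unfolded enumerates_eigenvalues_def]]
  obtain UA where UA: "similar_mat_wit A (mat_diag n (\<lambda>i. of_real (a (Suc i)))) UA (mat_adjoint UA)"
    by blast
  have "mat_adjoint B = (-1) \<cdot>\<^sub>m B" unfolding adjB by (auto intro!: eq_matI)
  from unitary_diagonalization[OF B this assms(11)[unfolded enumerates_eigenvalues_def]]
  obtain UB where UB: "similar_mat_wit B (mat_diag n (\<lambda>i. of_real (b (Suc i)) * \<i>)) UB (mat_adjoint UB)"
    by blast
  let ?L = "mat_adjoint X * X" and ?R = "X * mat_adjoint X"
  have L: "?L \<in> carrier_mat n n" and R: "?R \<in> carrier_mat n n" using X by auto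
  have "mat_adjoint ?L = ?L" "mat_adjoint ?R = ?R" using X by (simp_all add: mat_adjoint_mult[of _ n n _ n])
  then have adjLR: "mat_adjoint ?L = 1 \<cdot>\<^sub>m ?L" "mat_adjoint ?R = 1 \<cdot>\<^sub>m ?R" by (auto intro!: eq_matI)
  have cpL: "char_poly ?L = (\<Prod>i = 1..n. [:- complex_of_real ((\<sigma> i)\<^sup>2), 1:])"
    using assms(9) unfolding ordered_singular_values_def enumerates_eigenvalues_def by blast
  have cpR: "char_poly ?R = (\<Prod>i = 1..n. [:- complex_of_real ((\<sigma> i)\<^sup>2), 1:])"
    using cpL char_poly_mult_comm[of "mat_adjoint X" n X] X by simp
  from unitary_diagonalization[OF L adjLR(1) cpL] obtain V where
    V: "similar_mat_wit ?L (mat_diag n (\<lambda>i. of_real ((\<sigma> (Suc i))\<^sup>2))) V (mat_adjoint V)" by blast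
  from unitary_diagonalization[OF R adjLR(2) cpR] obtain U where
    U: "similar_mat_wit ?R (mat_diag n (\<lambda>i. of_real ((\<sigma> (Suc i))\<^sup>2))) U (mat_adjoint U)" by blast
  note Vc = similar_mat_witD2[OF L V] and Uc = similar_mat_witD2[OF R U]

  have \<sigma>: "(\<sigma> j)\<^sup>2 \<le> (\<sigma> i)\<^sup>2" if "1 \<le> i" "i \<le> j" "j \<le> n" for i j
    using assms(9) that unfolding ordered_singular_values_def by (intro power_mono) auto
  have \<gamma>: "(\<sigma> (Suc i))\<^sup>2 + (\<sigma> (Suc j))\<^sup>2 \<le> \<gamma>" if "i < n" "j < n" "(i, j) \<noteq> (0, 0)" for i j
  proof (cases "i = 0")
    case True
    then show ?thesis using \<sigma>[of 2 "Suc j"] that by (simp add: \<gamma>_def)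
  next
    case False
    then show ?thesis using \<sigma>[of 2 "Suc i"] \<sigma>[of 1 "Suc j"] that by (simp add: \<gamma>_def)
  qed
  have bound: "frobenius_sq (commutator X Y) \<le> (2 * (\<alpha> + \<beta>) + \<gamma>) * frobenius_sq Y"
    if "Y \<in> carrier_mat n n" "(mat_adjoint V * Y * U) $$ (0, 0) = 0" for Y
    by (rule commutator_bound[OF A B that(1) XAB adjA adjB UA UB V U \<alpha> \<beta> \<gamma> that(2)])

  have eigen_le: "t \<le> 2 * (\<alpha> + \<beta>) + \<gamma>"
    if ev: "mat_map_eigenvalue n (T_map X) (complex_of_real t)" for t
  proof (cases "t \<le> 0")
    case True
    \<comment> \<open>The bound is nonnegative because \<open>commutator_bound\<close> applies to some nonzero \<open>Y\<close>: take
      \<open>V\<^sup>* Y U\<close> to be the matrix unit at \<open>(0, 1)\<close>, which exists as \<open>n \<ge> 2\<close>.\<close>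
    define E :: "complex mat" where "E = mat n n (\<lambda>(i, j). if i = 0 \<and> j = 1 then 1 else 0)"
    define Y where "Y = V * E * mat_adjoint U"
    have E: "E \<in> carrier_mat n n" unfolding E_def by simp
    have Y: "Y \<in> carrier_mat n n"
      unfolding Y_def using E Uc(6) Vc(6) by (simp add: square_mat_simps[where n = n])
    have "mat_adjoint V * Y * U = mat_adjoint V * V * E * (mat_adjoint U * U)"
      unfolding Y_def using E Uc(6) Vc(6) by (simp add: square_mat_simps[where n = n])
    also have "\<dots> = E" unfolding Uc(2) Vc(2) using E by simp
    finally have YE: "mat_adjoint V * Y * U = E" .
    have "E $$ (0, 1) = 1" unfolding E_def using n by simp
    then have "Y \<noteq> 0\<^sub>m n n" using YE Uc(6) Vc(6) n by auto
    then have pos: "0 < frobenius_sq Y" by (rule frobenius_sq_pos[OF Y])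
    have "0 \<le> frobenius_sq (commutator X Y)" unfolding frobenius_sq_def by (simp add: sum_nonneg)
    also have "\<dots> \<le> (2 * (\<alpha> + \<beta>) + \<gamma>) * frobenius_sq Y"
      using n by (intro bound Y) (simp add: YE E_def)
    finally show ?thesis using pos True by (simp add: zero_le_mult_iff)
  next
    case False
    with n obtain Y where Y: "Y \<in> carrier_mat n n" "Y \<noteq> 0\<^sub>m n n" "T_map X Y = of_real t \<cdot>\<^sub>m Y"
      "(mat_adjoint V * Y * U) $$ (0, 0) = 0"
      using T_map_eigenvector_in_hyperplane[OF X _ ev mat_adjoint_carrier[OF Vc(6)] Uc(6)] by auto
    have "t * frobenius_sq Y \<le> (2 * (\<alpha> + \<beta>) + \<gamma>) * frobenius_sq Y"
      using bound[OF Y(1,4)] frobenius_sq_commutator_eigenvector[OF X Y(1,3)] by simp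
    then show ?thesis using frobenius_sq_pos[OF Y(1,2)] by simp
  qed
  have "lambda1_T X \<in> {t. mat_map_eigenvalue n (T_map X) (complex_of_real t)}"
    unfolding lambda1_T_def using X n finite_real_eigenvalues_T_map[OF X] T_map_zero_eigenvalue[OF X]
    by (subst carrier_matD(1)[OF X], intro Max_in) (auto intro!: exI[of _ 0])
  then have first: "lambda1_T X \<le> 2 * (\<alpha> + \<beta>) + \<gamma>" using eigen_le by blast

  have frobX: "frobenius_sq X = 1"
    using assms(3) frobenius_sq_trace[OF X] by (simp add: frobenius_norm_def)
  have shift: "(\<Sum>i<n. f (Suc i)) = (\<Sum>i\<in>{1..n}. f i)" for f :: "nat \<Rightarrow> real"
    by (simp add: sum.atLeast1_atMost_eq)
  have "mat_trace (A * A) = of_real (\<Sum>i\<in>{1..n}. (a i)\<^sup>2)"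
    unfolding trace_square(2)[OF A UA] shift[symmetric] by simp
  moreover have "mat_trace (B * B) = of_real (- (\<Sum>i\<in>{1..n}. (b i)\<^sup>2))"
    unfolding trace_square(2)[OF B UB] shift[symmetric] by (simp add: power_mult_distrib sum_negf)
  ultimately have ab: "(\<Sum>i\<in>{1..n}. (a i)\<^sup>2) + (\<Sum>i\<in>{1..n}. (b i)\<^sup>2) = 1"
    using frobX frobenius_sq_cartesian[OF A adjA B adjB] unfolding XAB by simp
  have "of_real (\<Sum>i\<in>{1..n}. (\<sigma> i)\<^sup>2) = mat_trace ?L"
    unfolding trace_square(1)[OF L V] shift[symmetric] by simp
  also have "\<dots> = of_real (frobenius_sq X)"
    using mat_trace_comm[of "mat_adjoint X" n n X] X by (simp add: frobenius_sq_trace[of _ n n])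
  finally have "(\<Sum>i\<in>{1..n}. (\<sigma> i)\<^sup>2) = 1" unfolding of_real_eq_iff frobX .
  moreover have "(\<Sum>i\<in>{1,2}. (\<sigma> i)\<^sup>2) \<le> (\<Sum>i\<in>{1..n}. (\<sigma> i)\<^sup>2)"
    using n by (intro sum_mono2) auto
  ultimately have "\<gamma> \<le> 1" unfolding \<gamma>_def by simp
  have max_le: "2 * Max (?prods c) \<le> (\<Sum>i\<in>{1..n}. (c i)\<^sup>2)" for c
  proof -
    obtain i j where "Max (?prods c) = - (c i * c j)" "i \<in> {1..n}" "j \<in> {1..n}"
      using Max_in[OF fin ne, of c] by blast
    then show ?thesis using neg_prod_le_sum_squares[of i "{1..n}" j c] by simp
  qed
  have "2 * \<alpha> \<le> (\<Sum>i\<in>{1..n}. (a i)\<^sup>2)" "2 * \<beta> \<le> (\<Sum>i\<in>{1..n}. (b i)\<^sup>2)"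
    unfolding \<alpha>_def \<beta>_def by (rule max_le)+
  then have "2 * \<alpha> + 2 * \<beta> \<le> 1" unfolding ab[symmetric] by (rule add_mono)
  with \<open>\<gamma> \<le> 1\<close> have "2 * (\<alpha> + \<beta>) + \<gamma> \<le> 2" by simp
  with first show ?thesis unfolding \<alpha>_def \<beta>_def \<gamma>_def by blast
qed

end
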